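(* Let $p\ge2$, $n\in\mathbb{N}$ and $t\in B_n^{(p)}$. Then the following hold: (a) $\mathrm{IT}(t)\in\mathbb{N}^n$. (b) Let $\mathbf{u}=\mathrm{IT}(t)$ and, for $i\in\{1,\ldots,(p-1)n+1\}$, let $\mathbf{v}=\mathrm{IT}(\beta_i(t))$. Then $$v_q=\begin{cases}u_q,&\text{if } q\in\{1,\ldots,l\};\\ i,&\text{if } q=l+1;\\ u_{q-1}+p-1,&\text{if } q\in\{l+2,\ldots,n+1\},\end{cases}$$ where $l=\max\bigl(\{0\}\cup\{q\in\{1,\ldots,n\}: u_q\le i\}\bigr)$. (c) $\mathrm{IT}[B_n^{(p)}]=M_{n,1}^{(p)}$ (the image of $B_n^{(p)}$ under $\mathrm{IT}$). (d) $\mathrm{IT}$ is an injective map. (e) Let $\mathbf{u}=\mathrm{IT}(t)$, $t_0=x$ and $t_i=\beta_{u_i}(t_{i-1})$ for $i\in\{1,\ldots,n\}$. Then $t=t_n$.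
   Context: $\mathbb{N}$ includes $0$; $p\ge 2$ is an integer. $T$ is the set of $p$-ary bracketings: terms (prefix notation) over the single variable $x$ and the $p$-ary operation symbol $\omega$, i.e. $x\in T$, and $\omega t_1\ldots t_p\in T$ whenever $t_1,\ldots,t_p\in T$. $|t|_\omega$ is the number of occurrences of $\omega$ and $|t|=(p-1)|t|_\omega+1$ the number of occurrences of $x$ in $t$. $B_n^{(p)}=\{t\in T:|t|_\omega=n\}$. For $i\ge1$, $\beta_i(t)$ is obtained from $t$ by replacing the $i$-th occurrence (from the left) of $x$ in $t$ by $\omega x\ldots x\in B_1^{(p)}$ (and $\beta_i(t)=t$ if $i>|t|$). The insertion tuple $\mathrm{IT}(t)$ of a bracketing $t\in T$ is the tuple of length $|t|_\omega$ whose $i$-th entry is one plus the number of $x$'s preceding the $i$-th symbol $\omega$ in the prefix notation of $t$. Equivalently: $\mathrm{IT}(x)=\emptyset$ (the empty tuple), and $\mathrm{IT}(\omega t_1\ldots t_p)$ is the concatenation $(1,\mathbf{v}^1,\ldots,\mathbf{v}^p)$, where $\mathbf{v}^i$ is $\mathrm{IT}(t_i)$ with $\sum_{k=1}^{i-1}|t_k|$ added to every entry. For $k\ge1$, $M_{n,k}^{(p)}$ is the set of all $\mathbf{u}\in\mathbb{N}^n$ with $1\le u_i\le(p-1)(i-1)+k$ for $1\le i\le n$ and $u_i\le u_j$ for $1\le i\le j\le n$. *)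

theory Defs
  imports Main
begin

datatype bracketing = Var | Omega "bracketing list"

inductive_set bracketings :: "nat \<Rightarrow> bracketing set" for p :: nat where
  Var: "Var \<in> bracketings p"
| Omega: "length ts = p \<Longrightarrow> \<forall>t\<in>set ts. t \<in> bracketings p \<Longrightarrow> Omega ts \<in> bracketings p"

datatype symbol = Sym_x | Sym_omega

fun prefix_notation :: "bracketing \<Rightarrow> symbol list" where
  "prefix_notation Var = [Sym_x]"
| "prefix_notation (Omega ts) = Sym_omega # concat (map prefix_notation ts)"

definition num_omega :: "bracketing \<Rightarrow> nat" where
  "num_omega t = count_list (prefix_notation t) Sym_omega"

definition num_x :: "bracketing \<Rightarrow> nat" where
  "num_x t = count_list (prefix_notation t) Sym_x"

definition B :: "nat \<Rightarrow> nat \<Rightarrow> bracketing set" where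
  "B p n = {t \<in> bracketings p. num_omega t = n}"

(* Occurrences of x are counted from 1; beta p i t = t for i = 0 and for i > num_x t. *)
fun beta :: "nat \<Rightarrow> nat \<Rightarrow> bracketing \<Rightarrow> bracketing"
  and beta_list :: "nat \<Rightarrow> nat \<Rightarrow> bracketing list \<Rightarrow> bracketing list" where
  "beta p i Var = (if i = 1 then Omega (replicate p Var) else Var)"
| "beta p i (Omega ts) = Omega (beta_list p i ts)"
| "beta_list p i [] = []"
| "beta_list p i (t # ts) =
     (if i \<le> num_x t then beta p i t # ts else t # beta_list p (i - num_x t) ts)"

(* Tuples are lists: the entry u_i, i = 1, 2, ..., is u ! (i - 1). *)

definition IT :: "bracketing \<Rightarrow> nat list" where
  "IT t = (let w = prefix_notation t in
     [1 + count_list (take j w) Sym_x. j \<leftarrow> [0..<length w], w ! j = Sym_omega])"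

definition M :: "nat \<Rightarrow> nat \<Rightarrow> nat \<Rightarrow> nat list set" where
  "M p n k = {u. length u = n
     \<and> (\<forall>i\<in>{1..n}. 1 \<le> u ! (i - 1) \<and> u ! (i - 1) \<le> (p - 1) * (i - 1) + k)
     \<and> (\<forall>i j. 1 \<le> i \<and> i \<le> j \<and> j \<le> n \<longrightarrow> u ! (i - 1) \<le> u ! (j - 1))}"

end

(* Every bracketing with an omega is beta_i of a smaller one in such a way that the new omega
   is the rightmost one, so that i is appended to the insertion tuple.
   On prefix words, beta_i replaces the i-th x by omega x ... x, which inserts i into the tuple and
   shifts all entries after it by p - 1. All parts then follow by induction on the number of omegas. *)
theory Submission
  imports Defs
begin

section \<open>Insertion tuples of arbitrary symbol words\<close>

text \<open>The counter \<open>c\<close> is one plus the number of x's already read. Defining the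
  tuple on all words, not only on prefix words, allows cutting a prefix word at any
  position.\<close>

fun insertion_entries :: "nat \<Rightarrow> symbol list \<Rightarrow> nat list" where
  "insertion_entries c [] = []"
| "insertion_entries c (Sym_x # w) = insertion_entries (Suc c) w"
| "insertion_entries c (Sym_omega # w) = c # insertion_entries c w"

text \<open>The left side is the list comprehension in \<open>IT\<close> after unfolding, with the
  constant 1 generalized to \<open>c\<close> for the induction.\<close>

lemma insertion_entries_conv_concat:
  "concat (map (\<lambda>j. if w ! j = Sym_omega then [c + count_list (take j w) Sym_x] else []) [0..<length w])
     = insertion_entries c w"
proof (induction c w rule: insertion_entries.induct)
  case (2 c w)
  have "[0..<length (Sym_x # w)] = 0 # map Suc [0..<length w]"
    by (simp add: map_Suc_upt upt_conv_Cons del: upt_Suc)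
  then show ?case using 2 by (simp add: comp_def cong: if_cong del: upt_Suc)
next
  case (3 c w)
  have "[0..<length (Sym_omega # w)] = 0 # map Suc [0..<length w]"
    by (simp add: map_Suc_upt upt_conv_Cons del: upt_Suc)
  then show ?case using 3 by (simp add: comp_def cong: if_cong del: upt_Suc)
qed simp

lemma IT_eq_insertion_entries: "IT t = insertion_entries 1 (prefix_notation t)"
  using insertion_entries_conv_concat[of "prefix_notation t" 1] by (simp add: IT_def Let_def)

lemma insertion_entries_append:
  "insertion_entries c (v @ w) = insertion_entries c v @ insertion_entries (c + count_list v Sym_x) w"
  by (induction c v rule: insertion_entries.induct) auto

lemma length_insertion_entries [simp]:
  "length (insertion_entries c w) = count_list w Sym_omega"
  by (induction c w rule: insertion_entries.induct) auto

lemma insertion_entries_replicate_x [simp]: "insertion_entries c (replicate k Sym_x) = []"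
  by (induction k arbitrary: c) auto

lemma set_insertion_entries:
  "set (insertion_entries c w) \<subseteq> {c..c + count_list w Sym_x}"
  by (induction c w rule: insertion_entries.induct) auto

lemma sorted_insertion_entries: "sorted (insertion_entries c w)"
proof (induction c w rule: insertion_entries.induct)
  case (3 c w)
  then show ?case using set_insertion_entries[of c w] by auto
qed auto

lemma insertion_entries_shift:
  "insertion_entries (c + d) w = map (\<lambda>e. e + d) (insertion_entries c w)"
  by (induction c w rule: insertion_entries.induct) auto

section \<open>The map beta on prefix words\<close>

lemma count_list_replicate_symbol [simp]:
  "count_list (replicate k a) b = (if a = b then k else 0)"
  by (induction k) auto

lemma prefix_notation_replicate_Var [simp]:
  "concat (map prefix_notation (replicate k Var)) = replicate k Sym_x"
  by (induction k) auto

lemma obtain_occurrence: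
  assumes "count_list w z \<ge> Suc i"
  obtains a b where "w = a @ z # b" "count_list a z = i"
proof -
  have "\<exists>a b. w = a @ z # b \<and> count_list a z = i"
    using assms
  proof (induction w arbitrary: i)
    case (Cons y w)
    consider "y \<noteq> z" | "y = z" "i = 0" | j where "y = z" "i = Suc j"
      by (cases i) auto
    then show ?case
    proof cases
      case 1
      with Cons.prems have "Suc i \<le> count_list w z" by simp
      from Cons.IH[OF this] obtain a b where "w = a @ z # b" "count_list a z = i" by blast
      with 1 show ?thesis by (intro exI[of _ "y # a"] exI[of _ b]) auto
    next
      case 2
      then show ?thesis by (intro exI[of _ "[]"] exI[of _ w]) auto
    next
      case 3
      with Cons.prems have "Suc j \<le> count_list w z" by simp
      from Cons.IH[OF this] obtain a b where "w = a @ z # b" "count_list a z = j" by blast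
      with 3 show ?thesis by (intro exI[of _ "y # a"] exI[of _ b]) auto
    qed
  qed simp
  then show thesis using that by blast
qed

text \<open>The i-th x is located by a splitting of the word with i - 1 copies of x on the left,
  which turns \<open>beta\<close> into a local replacement. The version for lists serves the mutual
  induction.\<close>

lemma prefix_notation_beta:
  "prefix_notation t = a @ Sym_x # b \<Longrightarrow> i = Suc (count_list a Sym_x)
     \<Longrightarrow> prefix_notation (beta p i t) = a @ Sym_omega # replicate p Sym_x @ b"
  and concat_prefix_notation_beta_list:
  "concat (map prefix_notation ts) = a @ Sym_x # b \<Longrightarrow> i = Suc (count_list a Sym_x)
     \<Longrightarrow> concat (map prefix_notation (beta_list p i ts)) = a @ Sym_omega # replicate p Sym_x @ b"
proof (induction p i t and p i ts arbitrary: a b and a b rule: beta_beta_list.induct)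
  case (1 p i)
  then have "a = []" "b = []" by (auto simp: Cons_eq_append_conv)
  with 1 show ?case by simp
next
  case (2 p i ts)
  from "2.prems"(1) obtain a' where a': "a = Sym_omega # a'"
    "concat (map prefix_notation ts) = a' @ Sym_x # b"
    by (auto simp: Cons_eq_append_conv)
  with 2 show ?case by simp
next
  case (3 p i)
  then show ?case by simp
next
  case (4 p i t ts)
  let ?W = "concat (map prefix_notation ts)"
  have eq: "prefix_notation t @ ?W = a @ Sym_x # b" using "4.prems" by simp
  show ?case
  proof (cases "i \<le> num_x t")
    \<comment> \<open>Here \<open>a\<close> contains fewer x's than the word of \<open>t\<close>, so
      the marked x lies inside that word.\<close>
    case True
    with eq "4.prems"(2) obtain b' where "prefix_notation t = a @ Sym_x # b'" "b = b' @ ?W"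
      by (auto simp: num_x_def append_eq_append_conv2 append_eq_Cons_conv)
    then show ?thesis using "4.IH"(1)[OF True] True "4.prems"(2) by simp
  next
    \<comment> \<open>Here the whole word of \<open>t\<close> lies to the left of the marked x,
      hence inside \<open>a\<close>.\<close>
    case False
    with eq "4.prems"(2) obtain a' where "a = prefix_notation t @ a'" "?W = a' @ Sym_x # b"
      by (auto simp: num_x_def append_eq_append_conv2 append_eq_Cons_conv)
    then show ?thesis using "4.IH"(2)[OF False] False "4.prems"(2) by (simp add: num_x_def)
  qed
qed

text \<open>The claim on lengths keeps the arity of each omega equal to \<open>p\<close>.\<close>

lemma beta_in_bracketings: "t \<in> bracketings p \<Longrightarrow> beta p i t \<in> bracketings p"
  and beta_list_in_bracketings:
  "set ts \<subseteq> bracketings p \<Longrightarrow>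
     set (beta_list p i ts) \<subseteq> bracketings p \<and> length (beta_list p i ts) = length ts"
proof (induction p i t and p i ts rule: beta_beta_list.induct)
  case (1 p i)
  then show ?case by (auto intro!: bracketings.intros)
next
  case (2 p i ts)
  from "2.prems" have "set ts \<subseteq> bracketings p" "length ts = p"
    by (auto elim: bracketings.cases)
  with "2.IH" show ?case by (auto intro!: bracketings.Omega)
qed auto

section \<open>Removing the rightmost omega\<close>

text \<open>Contracting the rightmost \<open>\<omega>\<close>: all its arguments are \<open>x\<close>, as is everything to its right.\<close>

lemma contract_last_omega:
  assumes "t \<in> bracketings p" "t \<noteq> Var"
  shows "\<exists>t'\<in>bracketings p. \<exists>a k. prefix_notation t' = a @ replicate (Suc k) Sym_x
           \<and> t = beta p (Suc (count_list a Sym_x)) t'"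
  using assms
proof (induction rule: bracketings.induct)
  case (Omega ts)
  have ts: "length ts = p" "\<forall>t\<in>set ts. t \<in> bracketings p"
    using Omega.hyps Omega.IH by auto
  \<comment> \<open>Sublists \<open>us\<close> of any length are considered, so that list induction
    applies while the induction hypothesis for the arguments in \<open>ts\<close> stays
    available.\<close>
  have list: "\<exists>ts'. length ts' = length us \<and> set ts' \<subseteq> bracketings p
      \<and> (\<exists>a k. concat (map prefix_notation ts') = a @ replicate (Suc k) Sym_x
           \<and> us = beta_list p (Suc (count_list a Sym_x)) ts')"
    if "set us \<subseteq> set ts" "\<not> set us \<subseteq> {Var}" for us
    using that
  proof (induction us)
    case (Cons s us)
    show ?case
    proof (cases "set us \<subseteq> {Var}")
      \<comment> \<open>The rightmost omega lies in the head \<open>s\<close>; the x's of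
        \<open>us\<close> only lengthen the final block.\<close>
      case True
      then have us: "us = replicate (length us) Var"
        by (auto intro!: replicate_eqI)
      from True Cons.prems have "s \<noteq> Var" "s \<in> set ts" by auto
      with Omega obtain s' a k where s': "s' \<in> bracketings p"
        "prefix_notation s' = a @ replicate (Suc k) Sym_x"
        "s = beta p (Suc (count_list a Sym_x)) s'"
        by blast
      have W: "concat (map prefix_notation us) = replicate (length us) Sym_x"
        by (metis us prefix_notation_replicate_Var)
      \<comment> \<open>This makes \<open>beta_list\<close> act on the head
        \<open>s'\<close>.\<close>
      have "num_x s' \<ge> Suc (count_list a Sym_x)"
        using s'(2) by (simp add: num_x_def)
      moreover have "concat (map prefix_notation (s' # us)) = a @ replicate (Suc (k + length us)) Sym_x"
        using s'(2) W by (simp add: replicate_add)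
      moreover have "set (s' # us) \<subseteq> bracketings p"
        using s'(1) Cons.prems ts by auto
      ultimately show ?thesis
        using s'(3)
        by (intro exI[of _ "s' # us"] conjI exI[of _ a] exI[of _ "k + length us"]) auto
    next
      case False
      with Cons obtain ts' a k where ts': "length ts' = length us" "set ts' \<subseteq> bracketings p"
        "concat (map prefix_notation ts') = a @ replicate (Suc k) Sym_x"
        "us = beta_list p (Suc (count_list a Sym_x)) ts'"
        by auto
      moreover have "s \<in> bracketings p" using Cons.prems ts by auto
      ultimately show ?thesis
        \<comment> \<open>Prepending the word of \<open>s\<close> raises the index by
          \<open>num_x s\<close>, so \<open>beta_list\<close> passes over \<open>s\<close>.\<close>
        by (intro exI[of _ "s # ts'"] conjI exI[of _ "prefix_notation s @ a"] exI[of _ k])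
          (auto simp: num_x_def)
    qed
  qed simp
  show ?case
  proof (cases "set ts \<subseteq> {Var}")
    case True
    then have "ts = replicate p Var"
      using ts by (auto intro!: replicate_eqI)
    then have "Omega ts = beta p (Suc (count_list [] Sym_x)) Var" by simp
    then show ?thesis
      by (intro bexI[of _ Var] exI[of _ "[]"] exI[of _ 0]) (auto intro: bracketings.Var)
  next
    case False
    with list[of ts] obtain ts' a k where ts': "length ts' = length ts" "set ts' \<subseteq> bracketings p"
      "concat (map prefix_notation ts') = a @ replicate (Suc k) Sym_x"
      "ts = beta_list p (Suc (count_list a Sym_x)) ts'"
      by auto
    then show ?thesis
      using ts(1)
      by (intro bexI[of _ "Omega ts'"] exI[of _ "Sym_omega # a"] exI[of _ k])
        (auto intro!: bracketings.Omega)
  qed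
qed simp

section \<open>Induction on the number of omegas\<close>

lemma B_0: "B p 0 = {Var}"
proof -
  have "t = Var" if "t \<in> B p 0" for t
    using that by (cases t) (auto simp: B_def num_omega_def)
  then show ?thesis by (auto simp: B_def num_omega_def intro: bracketings.Var)
qed

lemma length_IT: "length (IT t) = num_omega t"
  by (simp add: IT_eq_insertion_entries num_omega_def)

lemma sorted_IT: "sorted (IT t)"
  by (simp add: IT_eq_insertion_entries sorted_insertion_entries)

text \<open>The induction step of all later proofs. The replaced x belongs to the final block of x's
  in \<open>t'\<close>, so the new omega comes last and no entry has to be shifted.\<close>

lemma B_Suc_cases:
  assumes "t \<in> B p (Suc n)"
  obtains t' i where "t' \<in> B p n" "1 \<le> i" "i \<le> num_x t'" "t = beta p i t'" "IT t = IT t' @ [i]"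
    "num_x t + 1 = num_x t' + p"
proof -
  have t: "t \<in> bracketings p" "t \<noteq> Var" using assms by (auto simp: B_def num_omega_def)
  from contract_last_omega[OF this] obtain t' a k where t': "t' \<in> bracketings p"
    "prefix_notation t' = a @ replicate (Suc k) Sym_x"
    "t = beta p (Suc (count_list a Sym_x)) t'"
    by blast
  have w: "prefix_notation t = a @ Sym_omega # replicate p Sym_x @ replicate k Sym_x"
    using prefix_notation_beta[of t' a "replicate k Sym_x"] t' by simp
  show thesis
  proof (rule that[of t' "Suc (count_list a Sym_x)"])
    show "t' \<in> B p n" using assms w t' by (simp add: B_def num_omega_def)
    \<comment> \<open>Kept as \<open>replicate\<close>, the final blocks of x's contribute no
      entries.\<close>
    show "IT t = IT t' @ [Suc (count_list a Sym_x)]"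
      using w t'(2) by (simp add: IT_eq_insertion_entries insertion_entries_append
          del: replicate_Suc)
  qed (use w t' in \<open>auto simp: num_x_def\<close>)
qed

lemma num_x_eq:
  assumes "p \<ge> 1" "t \<in> B p n"
  shows "num_x t = (p - 1) * n + 1"
  using assms(2)
proof (induction n arbitrary: t)
  case 0
  then show ?case by (simp add: B_0 num_x_def)
next
  case (Suc n)
  from Suc.prems obtain t' where "t' \<in> B p n" "num_x t + 1 = num_x t' + p"
    by (rule B_Suc_cases)
  with Suc.IH[of t'] assms(1) show ?case by (cases p) auto
qed

section \<open>The effect of beta on the insertion tuple\<close>

text \<open>The witnesses are the parts of \<open>IT t\<close> before and after the \<open>i\<close>-th \<open>x\<close>.\<close>

lemma IT_beta:
  assumes "p \<ge> 1" "1 \<le> i" "i \<le> num_x t"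
  obtains us vs where "IT t = us @ vs" "IT (beta p i t) = us @ i # map (\<lambda>e. e + (p - 1)) vs"
    "\<forall>e\<in>set us. e \<le> i" "\<forall>e\<in>set vs. i < e"
proof -
  from assms(2,3) have "Suc (i - 1) \<le> count_list (prefix_notation t) Sym_x"
    by (simp add: num_x_def)
  then obtain a b where ab: "prefix_notation t = a @ Sym_x # b" "count_list a Sym_x = i - 1"
    by (rule obtain_occurrence)
  then have w: "prefix_notation (beta p i t) = a @ Sym_omega # replicate p Sym_x @ b"
    using prefix_notation_beta[of t a b i p] assms(2) by simp
  show thesis
  proof (rule that[of "insertion_entries 1 a" "insertion_entries (Suc i) b"])
    show "IT t = insertion_entries 1 a @ insertion_entries (Suc i) b"
      using ab assms(2) by (simp add: IT_eq_insertion_entries insertion_entries_append)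
    \<comment> \<open>Reading \<open>b\<close> now starts with the counter at i + p instead of i +
      1.\<close>
    show "IT (beta p i t) = insertion_entries 1 a @ i # map (\<lambda>e. e + (p - 1)) (insertion_entries (Suc i) b)"
      using w ab assms(1,2) insertion_entries_shift[of "Suc i" "p - 1" b]
      by (simp add: IT_eq_insertion_entries insertion_entries_append)
    show "\<forall>e\<in>set (insertion_entries 1 a). e \<le> i"
      using set_insertion_entries[of 1 a] ab(2) assms(2) by fastforce
    show "\<forall>e\<in>set (insertion_entries (Suc i) b). i < e"
      using set_insertion_entries[of "Suc i" b] by fastforce
  qed
qed

lemma num_omega_beta:
  assumes "p \<ge> 1" "1 \<le> i" "i \<le> num_x t"
  shows "num_omega (beta p i t) = Suc (num_omega t)"
  by (rule IT_beta[OF assms]) (simp flip: length_IT)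

text \<open>The entries not exceeding i are exactly those of omegas to the left of the i-th x, so
  \<open>l\<close> is the length of the first part in \<open>IT_beta\<close>.\<close>

lemma IT_beta_nth:
  fixes p i :: nat and t :: bracketing
  defines "n \<equiv> num_omega t"
  defines "l \<equiv> Max ({0} \<union> {q \<in> {1..n}. IT t ! (q - 1) \<le> i})"
  assumes "p \<ge> 1" "1 \<le> i" "i \<le> num_x t"
  shows "\<forall>q\<in>{1..l}. IT (beta p i t) ! (q - 1) = IT t ! (q - 1)"
    and "IT (beta p i t) ! l = i"
    and "\<forall>q\<in>{l + 2..n + 1}. IT (beta p i t) ! (q - 1) = IT t ! (q - 2) + (p - 1)"
proof -
  obtain us vs where uv: "IT t = us @ vs"
    "IT (beta p i t) = us @ i # map (\<lambda>e. e + (p - 1)) vs"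
    "\<forall>e\<in>set us. e \<le> i" "\<forall>e\<in>set vs. i < e"
    using IT_beta[OF assms(3-5)] .
  have n: "n = length us + length vs" using uv(1) length_IT[of t] by (simp add: n_def)
  have "{q \<in> {1..n}. IT t ! (q - 1) \<le> i} = {1..length us}"
    using uv(3,4) by (auto simp: uv(1) n nth_append not_less[symmetric] split: if_splits)
  \<comment> \<open>The added 0 covers the case where \<open>us\<close> is empty.\<close>
  moreover have "{0} \<union> {1..length us} = {..length us}" by auto
  ultimately have "l = Max {..length us}" by (simp only: l_def)
  then have l: "l = length us" by (auto intro: Max_eqI)
  show "\<forall>q\<in>{1..l}. IT (beta p i t) ! (q - 1) = IT t ! (q - 1)"
    by (auto simp: uv(1,2) l nth_append)
  show "IT (beta p i t) ! l = i"
    by (simp add: uv(2) l)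
  show "\<forall>q\<in>{l + 2..n + 1}. IT (beta p i t) ! (q - 1) = IT t ! (q - 2) + (p - 1)"
  proof
    fix q assume "q \<in> {l + 2..n + 1}"
    \<comment> \<open>\<open>r\<close> is the position in \<open>vs\<close>, counted from 0, of the
      entry that is shifted.\<close>
    then obtain r where r: "q = length us + 2 + r" "r < length vs"
      by (auto simp: l n le_iff_add)
    then show "IT (beta p i t) ! (q - 1) = IT t ! (q - 2) + (p - 1)"
      by (simp add: uv(1,2) nth_append)
  qed
qed

section \<open>The image of the insertion tuple map\<close>

lemma IT_append_in_M:
  assumes "u \<in> M p n k" "1 \<le> i" "i \<le> (p - 1) * n + k" "sorted (u @ [i])"
  shows "u @ [i] \<in> M p (Suc n) k"
  using assms by (auto simp: M_def nth_append sorted_append le_Suc_eq)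

lemma M_SucE:
  assumes "v \<in> M p (Suc n) k"
  obtains u i where "v = u @ [i]" "u \<in> M p n k" "1 \<le> i" "i \<le> (p - 1) * n + k" "\<forall>e\<in>set u. e \<le> i"
proof -
  from assms have len: "length v = Suc n" by (simp add: M_def)
  then obtain u i where v: "v = u @ [i]" "length u = n"
    by (auto simp: length_Suc_conv_rev)
  have bnd: "1 \<le> v ! (q - 1) \<and> v ! (q - 1) \<le> (p - 1) * (q - 1) + k" if "q \<in> {1..Suc n}" for q
    using assms that by (simp add: M_def)
  have mono: "v ! (q - 1) \<le> v ! (r - 1)" if "1 \<le> q" "q \<le> r" "r \<le> Suc n" for q r
    using assms that by (simp add: M_def)
  have nth: "u ! (q - 1) = v ! (q - 1)" if "1 \<le> q" "q \<le> n" for q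
  proof -
    have "q - 1 < n" using that by linarith
    then show ?thesis using v by (simp add: nth_append)
  qed
  show thesis
  proof (rule that[OF v(1)])
    show "u \<in> M p n k" using v(2) bnd mono by (simp add: M_def nth[simplified])
    show "1 \<le> i" "i \<le> (p - 1) * n + k" using bnd[of "Suc n"] v by auto
    show "\<forall>e\<in>set u. e \<le> i"
    proof
      fix e assume "e \<in> set u"
      then obtain j where "j < n" "e = u ! j" using v(2) by (auto simp: in_set_conv_nth)
      with mono[of "Suc j" "Suc n"] v show "e \<le> i" by (auto simp: nth_append)
    qed
  qed
qed

lemma IT_in_M:
  assumes "p \<ge> 1" "t \<in> B p n"
  shows "IT t \<in> M p n 1"
  using assms(2)
proof (induction n arbitrary: t)
  case 0
  then show ?case by (simp add: B_0 M_def IT_eq_insertion_entries)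
next
  case (Suc n)
  from Suc.prems obtain t' i where t': "t' \<in> B p n" "1 \<le> i" "i \<le> num_x t'" "IT t = IT t' @ [i]"
    by (rule B_Suc_cases)
  then show ?case
    using IT_append_in_M[OF Suc.IH[of t'], of i] sorted_IT[of t] num_x_eq[OF assms(1), of t' n]
    by simp
qed

text \<open>Once the tuple without its last entry i is realized by \<open>t\<close>, the bound on i
  says that \<open>t\<close> has an i-th x. As i is the largest entry, \<open>beta\<close> at this x
  appends i.\<close>

lemma IT_surj_M:
  assumes "p \<ge> 1" "u \<in> M p n 1"
  shows "u \<in> IT ` B p n"
  using assms(2)
proof (induction n arbitrary: u)
  case 0
  then show ?case by (simp add: B_0 M_def IT_eq_insertion_entries)
next
  case (Suc n)
  from Suc.prems obtain u' i where u: "u = u' @ [i]" "u' \<in> M p n 1" "1 \<le> i"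
    "i \<le> (p - 1) * n + 1" "\<forall>e\<in>set u'. e \<le> i"
    by (rule M_SucE)
  from Suc.IH[OF u(2)] obtain t where t: "t \<in> B p n" "u' = IT t" by blast
  have i: "i \<le> num_x t" using num_x_eq[OF assms(1) t(1)] u(4) by simp
  obtain us vs where uv: "IT t = us @ vs"
    "IT (beta p i t) = us @ i # map (\<lambda>e. e + (p - 1)) vs" "\<forall>e\<in>set vs. i < e"
    using IT_beta[OF assms(1) u(3) i] by metis
  \<comment> \<open>An entry of \<open>vs\<close> would exceed i, yet it occurs in
    \<open>u'\<close>, whose entries are at most i.\<close>
  have "vs = []" using u(5) uv t(2) by (cases vs) auto
  then have "IT (beta p i t) = u" using uv u(1) t(2) by simp
  moreover have "beta p i t \<in> B p (Suc n)"
    using t(1) num_omega_beta[OF assms(1) u(3) i] beta_in_bracketings by (simp add: B_def)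
  ultimately show ?case by blast
qed

section \<open>Reconstruction and injectivity\<close>

text \<open>In the decomposition of \<open>B_Suc_cases\<close> the tuple of \<open>t'\<close> is an
  initial segment of that of \<open>t\<close>, so the same sequence \<open>s\<close> reaches
  \<open>t'\<close> one step before \<open>t\<close>.\<close>

lemma beta_sequence_eq:
  assumes "t \<in> B p n" "s 0 = Var" "\<forall>i\<in>{1..n}. s i = beta p (IT t ! (i - 1)) (s (i - 1))"
  shows "t = s n"
  using assms(1,3)
proof (induction n arbitrary: t)
  case 0
  then show ?case using assms(2) by (simp add: B_0)
next
  case (Suc n)
  from Suc.prems(1) obtain t' i where t': "t' \<in> B p n" "t = beta p i t'" "IT t = IT t' @ [i]"
    by (rule B_Suc_cases)
  have len: "length (IT t') = n" using t'(1) by (simp add: length_IT B_def)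
  have "IT t ! (q - 1) = IT t' ! (q - 1)" if "q \<in> {1..n}" for q
  proof -
    have "q - 1 < n" using that by auto
    then show ?thesis by (simp add: t'(3) nth_append len)
  qed
  then have "t' = s n"
    using Suc.prems(2) by (intro Suc.IH[OF t'(1)]) auto
  moreover have "IT t ! n = i" using t'(3) len by (simp add: nth_append)
  ultimately show ?case using Suc.prems(2) t'(2) by simp
qed

text \<open>Bracketings with equal tuples have equally many omegas and are therefore the same term
  of one reconstruction sequence.\<close>

lemma inj_on_IT: "inj_on IT (bracketings p)"
proof (rule inj_onI)
  fix t t' assume "t \<in> bracketings p" "t' \<in> bracketings p" and eq: "IT t = IT t'"
  moreover have "num_omega t = num_omega t'" using eq by (metis length_IT)
  ultimately have B: "t \<in> B p (num_omega t)" "t' \<in> B p (num_omega t)" by (auto simp: B_def)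
  \<comment> \<open>The step from j to j + 1 uses the list entry at position j, which is the entry
    number j + 1 of the tuple.\<close>
  define s where "s = rec_nat Var (\<lambda>j. beta p (IT t ! j))"
  have "s 0 = Var" by (simp add: s_def)
  moreover have "\<forall>i\<in>{1..num_omega t}. s i = beta p (IT t ! (i - 1)) (s (i - 1))"
  proof
    fix i assume "i \<in> {1..num_omega t}"
    then show "s i = beta p (IT t ! (i - 1)) (s (i - 1))" by (cases i) (auto simp: s_def)
  qed
  ultimately show "t = t'"
    using beta_sequence_eq[OF B(1), of s] beta_sequence_eq[OF B(2), of s] eq by simp
qed

theorem proposition4p3:
  fixes p n :: nat and t :: bracketing
  assumes "p \<ge> 2" and "t \<in> B p n"
  shows "length (IT t) = n
    \<and> (\<forall>i\<in>{1..(p - 1) * n + 1}.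
         let u = IT t; v = IT (beta p i t);
             l = Max ({0} \<union> {q \<in> {1..n}. u ! (q - 1) \<le> i})
         in length v = n + 1
            \<and> (\<forall>q\<in>{1..l}. v ! (q - 1) = u ! (q - 1))
            \<and> v ! ((l + 1) - 1) = i
            \<and> (\<forall>q\<in>{l + 2..n + 1}. v ! (q - 1) = u ! ((q - 1) - 1) + (p - 1)))
    \<and> IT ` B p n = M p n 1
    \<and> inj_on IT (bracketings p)
    \<and> (let u = IT t in
         \<forall>s :: nat \<Rightarrow> bracketing.
           s 0 = Var \<and> (\<forall>i\<in>{1..n}. s i = beta p (u ! (i - 1)) (s (i - 1)))
           \<longrightarrow> t = s n)"
proof -
  have p: "p \<ge> 1" using assms(1) by simp
  have n: "num_omega t = n" using assms(2) by (simp add: B_def)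
  have b: "let u = IT t; v = IT (beta p i t);
             l = Max ({0} \<union> {q \<in> {1..n}. u ! (q - 1) \<le> i})
         in length v = n + 1
            \<and> (\<forall>q\<in>{1..l}. v ! (q - 1) = u ! (q - 1))
            \<and> v ! ((l + 1) - 1) = i
            \<and> (\<forall>q\<in>{l + 2..n + 1}. v ! (q - 1) = u ! ((q - 1) - 1) + (p - 1))"
    if "i \<in> {1..(p - 1) * n + 1}" for i
  proof -
    have i: "1 \<le> i" "i \<le> num_x t" using that num_x_eq[OF p assms(2)] by auto
    have "length (IT (beta p i t)) = n + 1"
      using num_omega_beta[OF p i] n by (simp add: length_IT)
    moreover have "q - 1 - 1 = q - 2" for q :: nat by simp
    ultimately show ?thesis
      using IT_beta_nth[OF p i] unfolding n Let_def by simp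
  qed
  have c: "IT ` B p n = M p n 1"
    using IT_in_M[OF p] IT_surj_M[OF p] by blast
  show ?thesis
    using b c inj_on_IT beta_sequence_eq[OF assms(2)] n unfolding Let_def
    by (auto simp only: length_IT)
qed

end
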